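(* Let $N>2$. For all $t<N$ and all $h_t\in H_t$, $F'_t(h_t)\subseteq V'_t(h_t)$.
   Context: Setting (vector-valued Markov decision process). Integers $N$ and $m\ge1$ are fixed. $S$ is a finite set of states; for each $s\in S$, $A_s$ is a nonempty compact set of actions; $A=\bigcup_{s\in S}A_s$. For $t=1,\dots,N-1$, $s\in S$, $a\in A_s$, $R_t(s,a)\in\mathbb{R}^m$ is a vector reward, with components continuous in $a\in A_s$; $p_t(j\mid s,a)$ is the probability of state $j\in S$ at epoch $t+1$ given action $a$ in state $s$ at epoch $t$, continuous in $a\in A_s$. $R_N(s)\in\mathbb{R}^m$ is the terminal reward. Histories and policies. For $t\le N$, $H_t=S^t$ is the set of histories $h_t=(s_1,\dots,s_t)$; $(h_t,j)=(s_1,\dots,s_t,j)$. For $t<N$, a $t$-decision rule is a map $d:H_t\to A$ with $d(s_1,\dots,s_t)\in A_{s_t}$; $D_t$ is the set of all $t$-decision rules, assumed compact (topology of pointwise convergence). A policy is $\pi=(d_1,\dots,d_{N-1})$ with $d_t\in D_t$; $P=D_1\times\cdots\times D_{N-1}$ is the set of all policies. Expected total rewards: $u_N^\pi(h_N)=R_N(s_N)$ and, for $t<N$, $h_t=(s_1,\dots,s_t)$, $$u_t^\pi(h_t)=R_t(s_t,d_t(h_t))+\sum_{j\in S}p_t(j\mid s_t,d_t(h_t))\,u_{t+1}^\pi(h_t,j).$$ Set $V'_t(h_t)=\{u_t^\pi(h_t):\pi\in P\}$ for $t\le N$. Order on $\mathbb{R}^m$: $x\ge y$ iff $x_i\ge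 y_i$ for all $i$. For $X\subseteq\mathbb{R}^m$, $e(X)=\{x\in X:\forall y\in X,\ y\ge x\Rightarrow y=x\}$. Define by backward recursion $U'_N(h_N)=\{R_N(s_N)\}$ and, for $t<N$, $h_t=(s_1,\dots,s_t)\in H_t$, $$F'_t(h_t)=\bigl\{R_t(s_t,a)+\textstyle\sum_{j\in S}p_t(j\mid s_t,a)v_j : a\in A_{s_t},\ v_j\in U'_{t+1}(h_t,j)\ \text{for all } j\in S\bigr\},\qquad U'_t(h_t)=e(F'_t(h_t)).$$ *)

theory Defs
  imports "HOL-Analysis.Analysis"
begin

record ('s, 'a, 'm) vmdp =
  horizon :: nat
  states :: "'s set"
  actions :: "'s \<Rightarrow> 'a set"
  reward :: "nat \<Rightarrow> 's \<Rightarrow> 'a \<Rightarrow> real ^ ('m::finite)"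
  trans_prob :: "nat \<Rightarrow> 's \<Rightarrow> 'a \<Rightarrow> 's \<Rightarrow> real"
  terminal_reward :: "'s \<Rightarrow> real ^ 'm"

text \<open>\<open>trans_prob M t s a j\<close> is the probability \<open>p\<^sub>t(j | s, a)\<close>. A history
  \<open>(s\<^sub>1, ..., s\<^sub>t)\<close> is the list \<open>[s\<^sub>1, ..., s\<^sub>t]\<close>, so its current state is \<open>last\<close>.\<close>

definition histories :: "('s, 'a, 'm::finite) vmdp \<Rightarrow> nat \<Rightarrow> 's list set" where
  "histories M t = {h. length h = t \<and> set h \<subseteq> states M}"

definition decision_rules :: "('s, 'a, 'm::finite) vmdp \<Rightarrow> nat \<Rightarrow> ('s list \<Rightarrow> 'a) set" where
  "decision_rules M t = (\<Pi>\<^sub>E h\<in>histories M t. actions M (last h))"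

definition policies :: "('s, 'a, 'm::finite) vmdp \<Rightarrow> (nat \<Rightarrow> 's list \<Rightarrow> 'a) set" where
  "policies M = (\<Pi>\<^sub>E t\<in>{1..<horizon M}. decision_rules M t)"

definition is_vmdp :: "('s, 'a::topological_space, 'm::finite) vmdp \<Rightarrow> bool" where
  "is_vmdp M \<longleftrightarrow>
     finite (states M) \<and>
     (\<forall>s\<in>states M. compact (actions M s) \<and> actions M s \<noteq> {}) \<and>
     (\<forall>t\<in>{1..<horizon M}. \<forall>s\<in>states M.
        (\<forall>i. continuous_on (actions M s) (\<lambda>a. reward M t s a $ i)) \<and>
        (\<forall>j\<in>states M. continuous_on (actions M s) (\<lambda>a. trans_prob M t s a j)) \<and>
        (\<forall>a\<in>actions M s. (\<forall>j\<in>states M. 0 \<le> trans_prob M t s a j) \<and>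
           (\<Sum>j\<in>states M. trans_prob M t s a j) = 1)) \<and>
     (\<forall>t\<in>{1..<horizon M}.
        compactin (product_topology (\<lambda>_. top_of_set (\<Union>s\<in>states M. actions M s)) (histories M t))
          (decision_rules M t))"

text \<open>The recursions below run backwards from \<open>t = horizon M\<close>; epochs beyond the horizon are
  irrelevant and get the terminal value.\<close>

function total_reward ::
  "('s, 'a, 'm::finite) vmdp \<Rightarrow> (nat \<Rightarrow> 's list \<Rightarrow> 'a) \<Rightarrow> nat \<Rightarrow> 's list \<Rightarrow> real ^ 'm" where
  "total_reward M \<pi> t h =
     (if t < horizon M
      then reward M t (last h) (\<pi> t h) +
           (\<Sum>j\<in>states M. trans_prob M t (last h) (\<pi> t h) j *\<^sub>R total_reward M \<pi> (Suc t) (h @ [j]))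
      else terminal_reward M (last h))"
  by pat_completeness auto
termination
  by (relation "Wellfounded.measure (\<lambda>(M, \<pi>, t, h). horizon M - t)") auto

declare total_reward.simps [simp del]

definition value_set :: "('s, 'a, 'm::finite) vmdp \<Rightarrow> nat \<Rightarrow> 's list \<Rightarrow> (real ^ 'm) set" where
  "value_set M t h = {total_reward M \<pi> t h | \<pi>. \<pi> \<in> policies M}"

text \<open>The library order on \<open>real ^ 'm\<close> is the componentwise one.\<close>

definition efficient :: "(real ^ 'm::finite) set \<Rightarrow> (real ^ 'm) set" where
  "efficient X = {x \<in> X. \<forall>y\<in>X. y \<ge> x \<longrightarrow> y = x}"

definition one_step ::
  "('s, 'a, 'm::finite) vmdp \<Rightarrow> nat \<Rightarrow> 's \<Rightarrow> ('s \<Rightarrow> (real ^ 'm) set) \<Rightarrow> (real ^ 'm) set" where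
  "one_step M t s W =
     {reward M t s a + (\<Sum>j\<in>states M. trans_prob M t s a j *\<^sub>R v j) | a v.
        a \<in> actions M s \<and> (\<forall>j\<in>states M. v j \<in> W j)}"

text \<open>\<open>eff_set\<close> and \<open>step_set\<close> are the mutually recursive sets \<open>U'\<close> and \<open>F'\<close>, with \<open>F'\<close>
  unfolded in the recursion for \<open>U'\<close>; thus \<open>eff_set M t h = efficient (step_set M t h)\<close>
  for \<open>t < horizon M\<close>.\<close>

function eff_set :: "('s, 'a, 'm::finite) vmdp \<Rightarrow> nat \<Rightarrow> 's list \<Rightarrow> (real ^ 'm) set" where
  "eff_set M t h =
     (if t < horizon M
      then efficient (one_step M t (last h) (\<lambda>j. eff_set M (Suc t) (h @ [j])))
      else {terminal_reward M (last h)})"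
  by pat_completeness auto
termination
  by (relation "Wellfounded.measure (\<lambda>(M, t, h). horizon M - t)") auto

declare eff_set.simps [simp del]

definition step_set :: "('s, 'a, 'm::finite) vmdp \<Rightarrow> nat \<Rightarrow> 's list \<Rightarrow> (real ^ 'm) set" where
  "step_set M t h = one_step M t (last h) (\<lambda>j. eff_set M (Suc t) (h @ [j]))"

lemma eff_set_horizon: "eff_set M (horizon M) h = {terminal_reward M (last h)}"
  by (simp add: eff_set.simps)

lemma eff_set_step: "t < horizon M \<Longrightarrow> eff_set M t h = efficient (step_set M t h)"
  by (subst eff_set.simps) (simp add: step_set_def)

end

theory Submission
  imports Defs
begin

text \<open>Decision rules depend on the whole history, so the expected reward from \<open>h\<close> onwards only
  involves the decisions at histories extending \<open>h\<close>. The continuations \<open>(h, j)\<close> for different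
  \<open>j\<close> have disjoint sets of extensions; hence policies attaining the chosen points \<open>v\<^sub>j\<close>
  and an arbitrary action at \<open>h\<close> can be glued into one policy. Backward induction then shows that
  every point of \<open>U'\<close> is attained.\<close>

lemma history_append: "h \<in> histories M t \<Longrightarrow> j \<in> states M \<Longrightarrow> h @ [j] \<in> histories M (Suc t)"
  by (auto simp: histories_def)

lemma last_history: "h \<in> histories M t \<Longrightarrow> t \<ge> 1 \<Longrightarrow> last h \<in> states M"
  by (cases h rule: rev_cases) (auto simp: histories_def)

lemma policies_nonempty:
  assumes "is_vmdp M"
  shows "policies M \<noteq> {}"
  using assms last_history[of _ M]
  by (fastforce simp: policies_def decision_rules_def PiE_eq_empty_iff is_vmdp_def)

lemma policies_action:
  "\<pi> \<in> policies M \<Longrightarrow> k \<in> {1..<horizon M} \<Longrightarrow> g \<in> histories M k \<Longrightarrow> \<pi> k g \<in> actions M (last g)"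
  by (auto simp: policies_def decision_rules_def PiE_iff)

text \<open>Since \<open>length h = t\<close>, the condition \<open>take t g = h\<close> says that
  \<open>g\<close> extends \<open>h\<close>. The recursion started at \<open>h\<close> evaluates the
  policy only at such histories.\<close>

lemma total_reward_cong:
  assumes "h \<in> histories M t"
    and "\<And>k g. t \<le> k \<Longrightarrow> k < horizon M \<Longrightarrow> g \<in> histories M k \<Longrightarrow> take t g = h \<Longrightarrow> \<pi> k g = \<pi>' k g"
  shows "total_reward M \<pi> t h = total_reward M \<pi>' t h"
  using assms
proof (induction "horizon M - t" arbitrary: t h)
  case 0
  then show ?case by (simp add: total_reward.simps)
next
  case (Suc n)
  have len: "length h = t" using Suc.prems(1) by (simp add: histories_def)
  have here: "\<pi> t h = \<pi>' t h"
    using Suc.hyps(2) Suc.prems len by simp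
  have "total_reward M \<pi> (Suc t) (h @ [j]) = total_reward M \<pi>' (Suc t) (h @ [j])"
    if j: "j \<in> states M" for j
  proof (rule Suc.hyps(1))
    show "n = horizon M - Suc t" using Suc.hyps(2) by simp
    show "h @ [j] \<in> histories M (Suc t)" using Suc.prems(1) j by (rule history_append)
    fix k g
    assume k: "Suc t \<le> k" "k < horizon M" "g \<in> histories M k" and g: "take (Suc t) g = h @ [j]"
    have "take t g = take t (take (Suc t) g)" by simp
    also have "\<dots> = h" using g len by simp
    finally show "\<pi> k g = \<pi>' k g" using k Suc.prems(2) by simp
  qed
  then show ?case
    using here by (simp add: total_reward.simps[of M _ t h])
qed

text \<open>The state that directly follows position \<open>length h\<close> decides which policy
  takes over. The last branch is a filler for the other histories that are not longer than
  \<open>h\<close>: the recursion from \<open>h\<close> never reads it, and \<open>last g\<close>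
  merely names some state whose policy supplies an admissible action.\<close>

definition glue_policy ::
  "('s, 'a, 'm::finite) vmdp \<Rightarrow> 's list \<Rightarrow> 'a \<Rightarrow> ('s \<Rightarrow> nat \<Rightarrow> 's list \<Rightarrow> 'a) \<Rightarrow> nat \<Rightarrow> 's list \<Rightarrow> 'a" where
  "glue_policy M h a P =
     (\<lambda>k\<in>{1..<horizon M}. \<lambda>g\<in>histories M k.
        if g = h then a
        else if length h < length g then P (g ! length h) k g
        else P (last g) k g)"

lemma glue_policy_in_policies:
  assumes "a \<in> actions M (last h)" and "\<And>j. j \<in> states M \<Longrightarrow> P j \<in> policies M"
  shows "glue_policy M h a P \<in> policies M"
proof -
  have "glue_policy M h a P k g \<in> actions M (last g)"
    if kg: "k \<in> {1..<horizon M}" "g \<in> histories M k" for k g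
  proof -
    \<comment> \<open>\<open>P j\<close> is known to be a policy only for states \<open>j\<close>,
      so both indices passed to \<open>P\<close> must be states. For \<open>last g\<close> this uses
      that \<open>k\<close> is at least 1, so that \<open>g\<close> is nonempty.\<close>
    have "last g \<in> states M" using kg last_history by auto
    moreover have "length h < length g \<Longrightarrow> g ! length h \<in> states M"
      using kg(2) nth_mem by (fastforce simp: histories_def)
    ultimately show ?thesis
      using kg assms(1) policies_action[OF assms(2) kg] by (auto simp: glue_policy_def)
  qed
  moreover have "glue_policy M h a P k g = undefined"
    if "k \<in> {1..<horizon M}" "g \<notin> histories M k" for k g
    using that by (simp add: glue_policy_def)
  moreover have "glue_policy M h a P k = undefined" if "k \<notin> {1..<horizon M}" for k
    unfolding glue_policy_def restrict_def by (simp only: that if_False)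
  ultimately show ?thesis
    unfolding policies_def decision_rules_def by (intro PiE_I) auto
qed

lemma total_reward_glue_policy:
  assumes "t \<in> {1..<horizon M}" and h: "h \<in> histories M t"
  shows "total_reward M (glue_policy M h a P) t h =
    reward M t (last h) a +
    (\<Sum>j\<in>states M. trans_prob M t (last h) a j *\<^sub>R total_reward M (P j) (Suc t) (h @ [j]))"
proof -
  have len: "length h = t" using h by (simp add: histories_def)
  have "total_reward M (glue_policy M h a P) (Suc t) (h @ [j]) = total_reward M (P j) (Suc t) (h @ [j])"
    if j: "j \<in> states M" for j
  proof (rule total_reward_cong)
    show "h @ [j] \<in> histories M (Suc t)" using h j by (rule history_append)
    fix k g
    assume k: "Suc t \<le> k" "k < horizon M" and g: "g \<in> histories M k" "take (Suc t) g = h @ [j]"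
    have "length g = k" using g(1) by (simp add: histories_def)
    \<comment> \<open>Lists are indexed from 0, so index \<open>t = length h\<close> holds the state
      right after \<open>h\<close>; every extension of \<open>h @ [j]\<close> thus falls into the
      branch that follows \<open>P j\<close>.\<close>
    moreover have "g ! t = j"
      using g(2) len by (metis lessI nth_append_length nth_take)
    ultimately show "glue_policy M h a P k g = P j k g"
      using k g(1) len by (auto simp: glue_policy_def)
  qed
  moreover have "glue_policy M h a P t h = a"
    using assms by (simp add: glue_policy_def)
  ultimately show ?thesis
    using assms(1) by (simp add: total_reward.simps[of M _ t h])
qed

text \<open>Choosing for each \<open>j\<close> a policy that attains \<open>v j\<close> and gluing
  these with \<open>a\<close> at \<open>h\<close> attains the given point. Both the backward
  induction and the final inclusion rest on this step.\<close>

lemma one_step_subset_value_set: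
  assumes t: "t \<in> {1..<horizon M}" and h: "h \<in> histories M t"
    and W: "\<And>j. j \<in> states M \<Longrightarrow> W j \<subseteq> value_set M (Suc t) (h @ [j])"
  shows "one_step M t (last h) W \<subseteq> value_set M t h"
proof
  fix x assume "x \<in> one_step M t (last h) W"
  then obtain a v where a: "a \<in> actions M (last h)" and v: "\<forall>j\<in>states M. v j \<in> W j"
    and x: "x = reward M t (last h) a + (\<Sum>j\<in>states M. trans_prob M t (last h) a j *\<^sub>R v j)"
    by (auto simp: one_step_def)
  have "\<forall>j\<in>states M. \<exists>\<pi>. \<pi> \<in> policies M \<and> v j = total_reward M \<pi> (Suc t) (h @ [j])"
    using W v unfolding value_set_def by blast
  then obtain P where P: "\<And>j. j \<in> states M \<Longrightarrow> P j \<in> policies M"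
      "\<And>j. j \<in> states M \<Longrightarrow> v j = total_reward M (P j) (Suc t) (h @ [j])"
    by metis
  have "x = total_reward M (glue_policy M h a P) t h"
    using total_reward_glue_policy[OF t h] P(2) x by simp
  then show "x \<in> value_set M t h"
    using glue_policy_in_policies[OF a P(1)] by (auto simp: value_set_def)
qed

lemma eff_set_subset_value_set:
  assumes "is_vmdp M" and "1 \<le> t" and "h \<in> histories M t"
  shows "eff_set M t h \<subseteq> value_set M t h"
  using assms(2,3)
proof (induction "horizon M - t" arbitrary: t h)
  case 0
  \<comment> \<open>From the horizon on, every policy yields the terminal reward, but the value set
    contains it only because some policy exists.\<close>
  then show ?case
    using policies_nonempty[OF assms(1)]
    by (auto simp: eff_set.simps total_reward.simps value_set_def)
next
  case (Suc n)
  \<comment> \<open>Passing to efficient points only shrinks the set.\<close>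
  have "eff_set M t h \<subseteq> one_step M t (last h) (\<lambda>j. eff_set M (Suc t) (h @ [j]))"
    using Suc.hyps(2) by (auto simp: eff_set_step step_set_def efficient_def)
  also have "\<dots> \<subseteq> value_set M t h"
  proof (rule one_step_subset_value_set)
    show "t \<in> {1..<horizon M}" using Suc by simp
    show "h \<in> histories M t" by fact
    show "eff_set M (Suc t) (h @ [j]) \<subseteq> value_set M (Suc t) (h @ [j])" if "j \<in> states M" for j
      using Suc.hyps Suc.prems that by (intro Suc.hyps(1) history_append) auto
  qed
  finally show ?case .
qed

theorem theorem3:
  fixes M :: "('s, 'a::topological_space, 'm::finite) vmdp"
  assumes "is_vmdp M" and "horizon M > 2"
  shows "\<forall>t\<in>{1..<horizon M}. \<forall>h\<in>histories M t. step_set M t h \<subseteq> value_set M t h"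
  unfolding step_set_def
  \<comment> \<open>The inclusion is used at epoch \<open>Suc t\<close>, which may be the horizon
    itself.\<close>
  using eff_set_subset_value_set[OF assms(1)]
  by (intro ballI one_step_subset_value_set) (auto intro: history_append)

end
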